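(* Let $G$ be a directed partially ordered abelian group that satisfies the Riesz decomposition property and let $H$ be a Dedekind complete lattice-ordered abelian group. Then $\operatorname{A}_{\operatorname{b}}^{\tau_o}(G,H)$ is an order closed ideal in $\operatorname{A}_{\operatorname{b}}(G,H)$.
   Context: Nets are indexed by non-empty upward directed partially ordered sets. For a net in a partially ordered set $P$, $x_\alpha\downarrow x$ means that $x_\alpha\le x_\beta$ whenever $\alpha\ge\beta$ and $\inf_\alpha x_\alpha=x$; $x_\alpha\uparrow x$ is defined dually. $[a,b]:=\{z\in P;\ a\le z\le b\}$. Order topology: $U\subseteq P$ is a net catching set for $x\in P$ if for all nets $(\hat x_\alpha)_{\alpha\in A}$, $(\check x_\alpha)_{\alpha\in A}$ in $P$ (same index set) with $\hat x_\alpha\uparrow x$ and $\check x_\alpha\downarrow x$ there is $\alpha\in A$ with $[\hat x_\alpha,\check x_\alpha]\subseteq U$. $O\subseteq P$ is order open if it is a net catching set for each of its points, and order closed if its complement is order open; the order open sets form the order topology $\tau_o(P)$. A map between partially ordered sets is order continuous if it is continuous with respect to the order topologies, and order bounded if it maps order bounded sets to order bounded sets. A partially ordered abelian group is an abelian group with a translation invariant partial order; $G_+=\{x\in G;\ x\ge0\}$. A partially ordered set is directed if any two elements have a common upper bound. $G$ has the Riesz decomposition property if for all $x,y\in G_+$ and $w\in[0,x+y]$ there are $u\in[0,x]$, $v\in[0,y]$ with $w=u+v$. It is lattice-ordered if it is a lattice; a lattice is Dedekind complete if every non-empty set bounded above has a supremum and every non-empty set bounded below has an infimum. A subset $M$ of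 a partially ordered set is full if $[x,y]\subseteq M$ for all $x,y\in M$. An ideal in a partially ordered abelian group is a directed full subgroup. $\operatorname{A}_{\operatorname{b}}(G,H)$ is the set of all order bounded additive maps (group homomorphisms) $G\to H$, with pointwise addition and the order $f\le g$ iff $f(x)\le g(x)$ for all $x\in G_+$; since $G$ is directed this is a partially ordered abelian group. $\operatorname{A}_{\operatorname{b}}^{\tau_o}(G,H)$ is the set of all order continuous maps in $\operatorname{A}_{\operatorname{b}}(G,H)$. *)

theory Defs
  imports
    "HOL-Analysis.Abstract_Topology"
    "HOL-Library.Lattice_Algebras"
    "HOL-Library.Lub_Glb"
begin

definition directed_set :: "'a::order set \<Rightarrow> bool"
  where "directed_set M \<longleftrightarrow> (\<forall>x\<in>M. \<forall>y\<in>M. \<exists>z\<in>M. x \<le> z \<and> y \<le> z)"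

definition full_set :: "'a::order set \<Rightarrow> bool"
  where "full_set M \<longleftrightarrow> (\<forall>x\<in>M. \<forall>y\<in>M. {x..y} \<subseteq> M)"

definition order_bounded_set :: "'a::order set \<Rightarrow> bool"
  where "order_bounded_set M \<longleftrightarrow> (\<exists>a b. M \<subseteq> {a..b})"

definition order_bounded_map :: "('a::order \<Rightarrow> 'b::order) \<Rightarrow> bool"
  where "order_bounded_map f \<longleftrightarrow> (\<forall>M. order_bounded_set M \<longrightarrow> order_bounded_set (f ` M))"

text \<open>An index set is a set \<open>A\<close> with an explicit partial order \<open>r\<close>; \<open>(\<alpha>, \<beta>) \<in> r\<close> means
  \<open>\<alpha> \<le> \<beta>\<close>.\<close>

definition directed_index :: "'i set \<Rightarrow> 'i rel \<Rightarrow> bool"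
  where "directed_index A r \<longleftrightarrow>
    A \<noteq> {} \<and> partial_order_on A r \<and> (\<forall>\<alpha>\<in>A. \<forall>\<beta>\<in>A. \<exists>\<gamma>\<in>A. (\<alpha>, \<gamma>) \<in> r \<and> (\<beta>, \<gamma>) \<in> r)"

definition net_increases_to :: "'i set \<Rightarrow> 'i rel \<Rightarrow> ('i \<Rightarrow> 'a::order) \<Rightarrow> 'a \<Rightarrow> bool"
  where "net_increases_to A r u x \<longleftrightarrow> (\<forall>(\<alpha>, \<beta>)\<in>r. u \<alpha> \<le> u \<beta>) \<and> isLub UNIV (u ` A) x"

definition net_decreases_to :: "'i set \<Rightarrow> 'i rel \<Rightarrow> ('i \<Rightarrow> 'a::order) \<Rightarrow> 'a \<Rightarrow> bool"
  where "net_decreases_to A r v x \<longleftrightarrow> (\<forall>(\<alpha>, \<beta>)\<in>r. v \<beta> \<le> v \<alpha>) \<and> isGlb UNIV (v ` A) x"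

text \<open>A definition in HOL cannot quantify over the type of indices, so the index sets here are
  arbitrary partially ordered subsets of \<open>'a \<times> 'a\<close>. This is no restriction: by
  \<open>net_catchingD\<close> below, the condition then holds for index sets in every type.\<close>

definition net_catching :: "'a::order set \<Rightarrow> 'a \<Rightarrow> bool"
  where "net_catching U x \<longleftrightarrow>
    (\<forall>(A :: ('a \<times> 'a) set) r u v.
       directed_index A r \<longrightarrow> net_increases_to A r u x \<longrightarrow> net_decreases_to A r v x \<longrightarrow>
       (\<exists>\<alpha>\<in>A. {u \<alpha>..v \<alpha>} \<subseteq> U))"

lemma net_catchingD:
  fixes A :: "'i set" and u v :: "'i \<Rightarrow> 'a::order"
  assumes U: "net_catching U x" and A: "directed_index A r"
    and u: "net_increases_to A r u x" and v: "net_decreases_to A r v x"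
  shows "\<exists>\<alpha>\<in>A. {u \<alpha>..v \<alpha>} \<subseteq> U"
proof -
  define D where "D = (\<lambda>\<alpha>. (u \<alpha>, v \<alpha>)) ` A"
  define s where "s = {(p, q). p \<in> D \<and> q \<in> D \<and> fst p \<le> fst q \<and> snd q \<le> snd p}"
  have "\<exists>\<gamma>\<in>D. (p, \<gamma>) \<in> s \<and> (q, \<gamma>) \<in> s" if pq: "p \<in> D" "q \<in> D" for p q
  proof -
    obtain \<alpha> \<beta> where ab: "\<alpha> \<in> A" "\<beta> \<in> A" "p = (u \<alpha>, v \<alpha>)" "q = (u \<beta>, v \<beta>)"
      using pq by (auto simp: D_def)
    obtain \<gamma> where "\<gamma> \<in> A" "(\<alpha>, \<gamma>) \<in> r" "(\<beta>, \<gamma>) \<in> r"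
      using A ab unfolding directed_index_def by blast
    with ab u v have "(u \<gamma>, v \<gamma>) \<in> D" "(p, (u \<gamma>, v \<gamma>)) \<in> s" "(q, (u \<gamma>, v \<gamma>)) \<in> s"
      by (auto simp: D_def s_def net_increases_to_def net_decreases_to_def)
    then show ?thesis by blast
  qed
  moreover have "partial_order_on D s"
    by (auto simp: s_def order_on_defs refl_on_def trans_def antisym_def prod_eq_iff)
  moreover have "D \<noteq> {}"
    using A by (auto simp: D_def directed_index_def)
  ultimately have "directed_index D s"
    unfolding directed_index_def by blast
  moreover have "net_increases_to D s fst x"
    using u by (auto simp: net_increases_to_def s_def D_def image_image)
  moreover have "net_decreases_to D s snd x"
    using v by (auto simp: net_decreases_to_def s_def D_def image_image)
  ultimately obtain p where "p \<in> D" "{fst p..snd p} \<subseteq> U"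
    using U unfolding net_catching_def by blast
  moreover then obtain \<alpha> where "\<alpha> \<in> A" "p = (u \<alpha>, v \<alpha>)"
    by (auto simp: D_def)
  ultimately show ?thesis
    by (intro bexI[of _ \<alpha>]) simp_all
qed

definition order_open :: "'a::order set \<Rightarrow> bool"
  where "order_open U \<longleftrightarrow> (\<forall>x\<in>U. net_catching U x)"

definition tau_o :: "'a::order topology"
  where "tau_o = topology order_open"

lemma istopology_order_open: "istopology (order_open :: 'a::order set \<Rightarrow> bool)"
  unfolding istopology_def
proof (intro conjI allI impI)
  fix S T :: "'a set"
  assume S: "order_open S" and T: "order_open T"
  have "net_catching (S \<inter> T) x" if x: "x \<in> S \<inter> T" for x
    unfolding net_catching_def
  proof (intro allI impI)
    fix A :: "('a \<times> 'a) set" and r u v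
    assume A: "directed_index A r" and u: "net_increases_to A r u x"
      and v: "net_decreases_to A r v x"
    obtain \<alpha> \<beta> where \<alpha>: "\<alpha> \<in> A" "{u \<alpha>..v \<alpha>} \<subseteq> S" and \<beta>: "\<beta> \<in> A" "{u \<beta>..v \<beta>} \<subseteq> T"
      using S T x A u v unfolding order_open_def net_catching_def by blast
    obtain \<gamma> where \<gamma>: "\<gamma> \<in> A" "(\<alpha>, \<gamma>) \<in> r" "(\<beta>, \<gamma>) \<in> r"
      using A \<alpha>(1) \<beta>(1) unfolding directed_index_def by blast
    have "u \<alpha> \<le> u \<gamma>" "u \<beta> \<le> u \<gamma>" "v \<gamma> \<le> v \<alpha>" "v \<gamma> \<le> v \<beta>"
      using u v \<gamma> by (auto simp: net_increases_to_def net_decreases_to_def)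
    then have "{u \<gamma>..v \<gamma>} \<subseteq> {u \<alpha>..v \<alpha>}" "{u \<gamma>..v \<gamma>} \<subseteq> {u \<beta>..v \<beta>}"
      by auto
    with \<alpha> \<beta> \<gamma> show "\<exists>\<alpha>\<in>A. {u \<alpha>..v \<alpha>} \<subseteq> S \<inter> T"
      by blast
  qed
  then show "order_open (S \<inter> T)"
    by (simp add: order_open_def)
next
  fix K :: "'a set set"
  assume K: "\<forall>S\<in>K. order_open S"
  have "net_catching (\<Union>K) x" if "S \<in> K" "x \<in> S" for S x
  proof -
    have "net_catching S x"
      using K that by (auto simp: order_open_def)
    then show ?thesis
      unfolding net_catching_def using \<open>S \<in> K\<close> by (meson Union_upper subset_trans)
  qed
  then show "order_open (\<Union>K)"
    by (auto simp: order_open_def)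
qed

lemma openin_tau_o [simp]: "openin tau_o U \<longleftrightarrow> order_open U"
  by (simp add: tau_o_def topology_inverse' istopology_order_open)

lemma topspace_tau_o [simp]: "topspace tau_o = UNIV"
proof -
  have "order_open (UNIV :: 'a set)"
    unfolding order_open_def net_catching_def directed_index_def by blast
  then show ?thesis
    by (metis openin_subset openin_tau_o top.extremum_uniqueI)
qed

abbreviation order_closed :: "'a::order set \<Rightarrow> bool"
  where "order_closed \<equiv> closedin tau_o"

abbreviation order_continuous :: "('a::order \<Rightarrow> 'b::order) \<Rightarrow> bool"
  where "order_continuous \<equiv> continuous_map tau_o tau_o"

class directed_ordered_ab_group_add = ordered_ab_group_add +
  assumes directed: "\<exists>z. x \<le> z \<and> y \<le> z"

definition riesz_decomposition :: "'a::ordered_ab_group_add itself \<Rightarrow> bool"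
  where "riesz_decomposition TYPE('a) \<longleftrightarrow>
    (\<forall>(x::'a) y w. 0 \<le> x \<longrightarrow> 0 \<le> y \<longrightarrow> w \<in> {0..x + y} \<longrightarrow>
       (\<exists>u\<in>{0..x}. \<exists>v\<in>{0..y}. w = u + v))"

definition subgroup_add :: "'a::ab_group_add set \<Rightarrow> bool"
  where "subgroup_add M \<longleftrightarrow> 0 \<in> M \<and> (\<forall>x\<in>M. \<forall>y\<in>M. x + y \<in> M) \<and> (\<forall>x\<in>M. - x \<in> M)"

definition order_ideal :: "'a::ordered_ab_group_add set \<Rightarrow> bool"
  where "order_ideal M \<longleftrightarrow> subgroup_add M \<and> directed_set M \<and> full_set M"

lemma order_bounded_map_zero: "order_bounded_map (\<lambda>_. 0 :: 'b::{order,zero})"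
  unfolding order_bounded_map_def order_bounded_set_def
  by (intro allI impI exI[of _ 0]) auto

lemma order_bounded_map_add:
  fixes f g :: "'a::order \<Rightarrow> 'b::ordered_ab_group_add"
  assumes "order_bounded_map f" "order_bounded_map g"
  shows "order_bounded_map (\<lambda>x. f x + g x)"
  unfolding order_bounded_map_def
proof (intro allI impI)
  fix M :: "'a set" assume "order_bounded_set M"
  then obtain a b c d where "f ` M \<subseteq> {a..b}" "g ` M \<subseteq> {c..d}"
    using assms unfolding order_bounded_map_def order_bounded_set_def by meson
  then have "(\<lambda>x. f x + g x) ` M \<subseteq> {a + c..b + d}"
    by (auto simp: image_subset_iff intro!: add_mono)
  then show "order_bounded_set ((\<lambda>x. f x + g x) ` M)"
    unfolding order_bounded_set_def by blast
qed

lemma order_bounded_map_uminus: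
  fixes f :: "'a::order \<Rightarrow> 'b::ordered_ab_group_add"
  assumes "order_bounded_map f"
  shows "order_bounded_map (\<lambda>x. - f x)"
  unfolding order_bounded_map_def
proof (intro allI impI)
  fix M :: "'a set" assume "order_bounded_set M"
  then obtain a b where "f ` M \<subseteq> {a..b}"
    using assms unfolding order_bounded_map_def order_bounded_set_def by meson
  then have "(\<lambda>x. - f x) ` M \<subseteq> {- b..- a}"
    by (auto simp: image_subset_iff)
  then show "order_bounded_set ((\<lambda>x. - f x) ` M)"
    unfolding order_bounded_set_def by blast
qed

typedef (overloaded) ('g, 'h) Ab =
  "{f :: 'g::ordered_ab_group_add \<Rightarrow> 'h::ordered_ab_group_add. additive f \<and> order_bounded_map f}"
  morphisms ab_apply Abs_Ab
  by (rule exI[of _ "\<lambda>_. 0"]) (simp add: additive_def order_bounded_map_zero)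

setup_lifting type_definition_Ab

instantiation Ab :: (ordered_ab_group_add, ordered_ab_group_add) ab_group_add
begin

lift_definition zero_Ab :: "('a, 'b) Ab" is "\<lambda>_. 0"
  by (simp add: additive_def order_bounded_map_zero)

lift_definition plus_Ab :: "('a, 'b) Ab \<Rightarrow> ('a, 'b) Ab \<Rightarrow> ('a, 'b) Ab" is "\<lambda>f g x. f x + g x"
  by (simp add: additive_def order_bounded_map_add)

lift_definition uminus_Ab :: "('a, 'b) Ab \<Rightarrow> ('a, 'b) Ab" is "\<lambda>f x. - f x"
  by (simp add: additive_def order_bounded_map_uminus)

definition minus_Ab :: "('a, 'b) Ab \<Rightarrow> ('a, 'b) Ab \<Rightarrow> ('a, 'b) Ab"
  where "minus_Ab f g = f + - g"

instance
proof
  fix f g h :: "('a, 'b) Ab"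
  show "f + g + h = f + (g + h)" by transfer (simp add: add.assoc)
  show "f + g = g + f" by transfer (simp add: add.commute)
  show "0 + f = f" by transfer simp
  show "- f + f = 0" by transfer simp
  show "f - g = f + - g" by (rule minus_Ab_def)
qed

end

text \<open>Antisymmetry of the order on maps depends on the domain being directed: every element is
  then a difference of positive ones.\<close>

lemma additive_eqI:
  fixes f g :: "'a::directed_ordered_ab_group_add \<Rightarrow> 'b::ab_group_add"
  assumes "additive f" "additive g" and eq: "\<And>x. 0 \<le> x \<Longrightarrow> f x = g x"
  shows "f = g"
proof
  fix x :: 'a
  obtain z where z: "x \<le> z" "0 \<le> z" using directed by blast
  have "f z - f (z - x) = g z - g (z - x)"
    using z by (simp add: eq)
  then show "f x = g x"
    using assms(1,2) by (simp add: additive.diff)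
qed

instantiation Ab :: (directed_ordered_ab_group_add, ordered_ab_group_add) ordered_ab_group_add
begin

lift_definition less_eq_Ab :: "('a, 'b) Ab \<Rightarrow> ('a, 'b) Ab \<Rightarrow> bool" is "\<lambda>f g. \<forall>x\<ge>0. f x \<le> g x" .

definition less_Ab :: "('a, 'b) Ab \<Rightarrow> ('a, 'b) Ab \<Rightarrow> bool"
  where "less_Ab f g \<longleftrightarrow> f \<le> g \<and> \<not> g \<le> f"

instance
proof
  fix f g h :: "('a, 'b) Ab"
  show "f < g \<longleftrightarrow> f \<le> g \<and> \<not> g \<le> f" by (rule less_Ab_def)
  show "f \<le> f" by transfer simp
  show "f \<le> g \<Longrightarrow> g \<le> h \<Longrightarrow> f \<le> h" by transfer (meson order_trans)
  show "f \<le> g \<Longrightarrow> g \<le> f \<Longrightarrow> f = g" by transfer (blast intro: additive_eqI order_antisym)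
  show "f \<le> g \<Longrightarrow> h + f \<le> h + g" by transfer (simp add: add_left_mono)
qed

end

definition Ab_tau_o :: "('g::ordered_ab_group_add, 'h::ordered_ab_group_add) Ab set"
  where "Ab_tau_o = {f. order_continuous (ab_apply f)}"

end

theory Submission
  imports Defs
begin

text \<open>By the Riesz--Kantorovich construction every \<open>f\<close> in \<open>A\<^sub>b(G, H)\<close> has a positive part \<open>p\<close> with
  \<open>p x = Sup (f ` {0..x})\<close> for \<open>x \<ge> 0\<close>. A positive map is order continuous iff it sends nets
  decreasing to \<open>0\<close> to nets with infimum \<open>0\<close>, and the point is that \<open>f\<close> is order continuous iff the
  positive parts of \<open>f\<close> and \<open>- f\<close> are (Ogasawara). For this, let \<open>x\<^sub>\<alpha>\<close> decrease to \<open>0\<close> below \<open>y\<close> and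
  split \<open>z \<in> [0, y]\<close> as \<open>z = a\<^sub>\<alpha> + b\<^sub>\<alpha>\<close> with \<open>a\<^sub>\<alpha> \<in> [0, x\<^sub>\<alpha>]\<close> and \<open>b\<^sub>\<alpha> \<in> [0, y - x\<^sub>\<alpha>]\<close>. A lower bound \<open>c\<close>
  of the \<open>p x\<^sub>\<alpha>\<close> satisfies \<open>c - p y + f z \<le> f a\<^sub>\<alpha>\<close>; the order topology sees arbitrary elements of
  \<open>[0, x\<^sub>\<alpha>]\<close>, so continuity of \<open>f\<close> at \<open>0\<close> gives \<open>c \<le> p y - f z\<close>, and the supremum over \<open>z\<close> yields
  \<open>c \<le> 0\<close>. Order closedness holds because decreasing nets in \<open>A\<^sub>b(G, H)\<close> have pointwise infima.\<close>

section \<open>Monotone nets in partially ordered groups\<close>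

lemma net_decreases_to_iff_minus:
  fixes v :: "'i \<Rightarrow> 'a::ordered_ab_group_add"
  shows "net_decreases_to A r v x \<longleftrightarrow> net_increases_to A r (\<lambda>\<alpha>. - v \<alpha>) (- x)"
proof -
  have "isGlb UNIV (v ` A) x \<longleftrightarrow> isLub UNIV ((\<lambda>\<alpha>. - v \<alpha>) ` A) (- x)"
    unfolding isGlb_def isLub_def leastP_def greatestP_def isUb_def isLb_def setle_def setge_def
    by auto (metis minus_le_iff neg_le_iff_le)+
  then show ?thesis
    by (simp add: net_decreases_to_def net_increases_to_def)
qed

lemma net_increases_to_ge: "net_increases_to A r u x \<Longrightarrow> \<alpha> \<in> A \<Longrightarrow> u \<alpha> \<le> x"
  by (auto simp: net_increases_to_def isLub_def isUb_def leastP_def setle_def)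

lemma net_decreases_to_le: "net_decreases_to A r v x \<Longrightarrow> \<alpha> \<in> A \<Longrightarrow> x \<le> v \<alpha>"
  by (auto simp: net_decreases_to_def isGlb_def isLb_def greatestP_def setge_def)

lemma net_increases_to_least:
  "net_increases_to A r u x \<Longrightarrow> (\<And>\<alpha>. \<alpha> \<in> A \<Longrightarrow> u \<alpha> \<le> c) \<Longrightarrow> x \<le> c"
  by (auto simp: net_increases_to_def isLub_def isUb_def leastP_def setle_def setge_def)

lemma net_decreases_to_greatest:
  "net_decreases_to A r v x \<Longrightarrow> (\<And>\<alpha>. \<alpha> \<in> A \<Longrightarrow> c \<le> v \<alpha>) \<Longrightarrow> c \<le> x"
  by (auto simp: net_decreases_to_def isGlb_def isLb_def greatestP_def setle_def setge_def)

lemma net_increases_toI: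
  assumes "\<And>\<alpha> \<beta>. (\<alpha>, \<beta>) \<in> r \<Longrightarrow> u \<alpha> \<le> u \<beta>" "\<And>\<alpha>. \<alpha> \<in> A \<Longrightarrow> u \<alpha> \<le> x"
    and "\<And>c. (\<And>\<alpha>. \<alpha> \<in> A \<Longrightarrow> u \<alpha> \<le> c) \<Longrightarrow> x \<le> c"
  shows "net_increases_to A r u x"
  using assms by (auto simp: net_increases_to_def isLub_def isUb_def leastP_def setle_def setge_def)

lemma net_decreases_toI:
  assumes "\<And>\<alpha> \<beta>. (\<alpha>, \<beta>) \<in> r \<Longrightarrow> v \<beta> \<le> v \<alpha>" "\<And>\<alpha>. \<alpha> \<in> A \<Longrightarrow> x \<le> v \<alpha>"
    and "\<And>c. (\<And>\<alpha>. \<alpha> \<in> A \<Longrightarrow> c \<le> v \<alpha>) \<Longrightarrow> c \<le> x"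
  shows "net_decreases_to A r v x"
  using assms by (auto simp: net_decreases_to_def isGlb_def isLb_def greatestP_def setle_def setge_def)

lemma net_increases_toD: "net_increases_to A r u x \<Longrightarrow> (\<alpha>, \<beta>) \<in> r \<Longrightarrow> u \<alpha> \<le> u \<beta>"
  by (auto simp: net_increases_to_def)

lemma net_decreases_toD: "net_decreases_to A r v x \<Longrightarrow> (\<alpha>, \<beta>) \<in> r \<Longrightarrow> v \<beta> \<le> v \<alpha>"
  by (auto simp: net_decreases_to_def)

lemma net_increases_to_const: "directed_index A r \<Longrightarrow> net_increases_to A r (\<lambda>_. x) x"
  by (rule net_increases_toI) (auto simp: directed_index_def)

lemma directed_indexE:
  assumes "directed_index A r" "\<alpha> \<in> A" "\<beta> \<in> A"
  obtains \<gamma> where "\<gamma> \<in> A" "(\<alpha>, \<gamma>) \<in> r" "(\<beta>, \<gamma>) \<in> r"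
  using assms unfolding directed_index_def by blast

text \<open>Directedness decouples the two nets: for indices \<open>\<alpha>\<close> and
  \<open>\<beta>\<close>, a common majorant \<open>\<gamma>\<close> shows that a lower bound of the
  net of differences lies below \<open>v \<alpha> - u \<beta>\<close>. The infimum over
  \<open>\<alpha>\<close> and the supremum over \<open>\<beta>\<close> are then taken one after the
  other.\<close>

lemma net_decreases_to_diff:
  fixes u v :: "'i \<Rightarrow> 'a::ordered_ab_group_add"
  assumes A: "directed_index A r"
    and v: "net_decreases_to A r v x" and u: "net_increases_to A r u y"
  shows "net_decreases_to A r (\<lambda>\<alpha>. v \<alpha> - u \<alpha>) (x - y)"
proof (rule net_decreases_toI)
  show "v \<beta> - u \<beta> \<le> v \<alpha> - u \<alpha>" if "(\<alpha>, \<beta>) \<in> r" for \<alpha> \<beta>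
    using that u v by (intro diff_mono net_increases_toD[OF u] net_decreases_toD[OF v])
  show "x - y \<le> v \<alpha> - u \<alpha>" if "\<alpha> \<in> A" for \<alpha>
    using that by (intro diff_mono net_increases_to_ge[OF u] net_decreases_to_le[OF v])
  fix c assume c: "\<And>\<alpha>. \<alpha> \<in> A \<Longrightarrow> c \<le> v \<alpha> - u \<alpha>"
  have le: "c + u \<beta> \<le> v \<alpha>" if ab: "\<alpha> \<in> A" "\<beta> \<in> A" for \<alpha> \<beta>
  proof -
    obtain \<gamma> where \<gamma>: "\<gamma> \<in> A" "(\<alpha>, \<gamma>) \<in> r" "(\<beta>, \<gamma>) \<in> r"
      using directed_indexE[OF A ab] .
    have "c \<le> v \<gamma> - u \<gamma>" by (rule c[OF \<gamma>(1)])
    also have "\<dots> \<le> v \<alpha> - u \<beta>"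
      by (intro diff_mono net_increases_toD[OF u] net_decreases_toD[OF v] \<gamma>)
    finally show ?thesis by (simp add: le_diff_eq)
  qed
  have "c + u \<beta> \<le> x" if "\<beta> \<in> A" for \<beta>
    by (rule net_decreases_to_greatest[OF v]) (rule le[OF _ that])
  then have "u \<beta> \<le> x - c" if "\<beta> \<in> A" for \<beta>
    using that by (simp add: le_diff_eq add.commute)
  then have "y \<le> x - c"
    by (rule net_increases_to_least[OF u])
  then show "c \<le> x - y" by (simp add: le_diff_eq add.commute)
qed

section \<open>Additive maps\<close>

text \<open>In a directed group every \<open>x\<close> is a difference of positive elements, and
  additivity on the cone makes the value independent of the chosen difference.\<close>

lemma additive_extension:
  fixes q :: "'a::directed_ordered_ab_group_add \<Rightarrow> 'b::ab_group_add"
  assumes q: "\<And>x y. 0 \<le> x \<Longrightarrow> 0 \<le> y \<Longrightarrow> q (x + y) = q x + q y"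
  obtains p where "additive p" "\<And>x. 0 \<le> x \<Longrightarrow> p x = q x"
proof
  define z where "z x = (SOME z. x \<le> z \<and> 0 \<le> z)" for x :: 'a
  have z: "x \<le> z x" "0 \<le> z x" for x
    using someI_ex[OF directed[of x 0]] by (auto simp: z_def)
  define p where "p x = q (z x) - q (z x - x)" for x
  \<comment> \<open>Any representation computes \<open>p x\<close>. Additivity follows because
    \<open>z x + z y\<close> serves as well as \<open>z (x + y)\<close> for the sum
    \<open>x + y\<close>.\<close>
  have p: "p x = q s - q t" if "x = s - t" "0 \<le> s" "0 \<le> t" for x s t
  proof -
    have "z x + t = s + (z x - x)" using that by simp
    then have "q (z x) + q t = q s + q (z x - x)"
      using z[of x] that q[of "z x" t] q[of s "z x - x"] by simp
    then show ?thesis by (simp add: p_def algebra_simps)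
  qed
  show "additive p"
  proof
    fix x y
    have "p (x + y) = q (z x + z y) - q ((z x - x) + (z y - y))"
      by (rule p) (use z in \<open>auto intro: add_nonneg_nonneg\<close>)
    also have "\<dots> = p x + p y"
      using z by (simp add: p_def q)
    finally show "p (x + y) = p x + p y" .
  qed
  have "q 0 = 0" using q[of 0 0] by simp
  then show "p x = q x" if "0 \<le> x" for x
    using p[of x x 0] that by simp
qed

lemma additive_mono:
  fixes p :: "'a::ordered_ab_group_add \<Rightarrow> 'b::ordered_ab_group_add"
  assumes "additive p" "\<And>x. 0 \<le> x \<Longrightarrow> 0 \<le> p x" "x \<le> y"
  shows "p x \<le> p y"
  using assms(2)[of "y - x"] assms(3) by (simp add: additive.diff[OF assms(1)])

text \<open>A positive additive map is monotone, so it sends \<open>{a..b}\<close> into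
  \<open>{p a..p b}\<close> and is order bounded.\<close>

lemma additive_nonneg_Ab:
  fixes p :: "'a::ordered_ab_group_add \<Rightarrow> 'b::ordered_ab_group_add"
  assumes "additive p" "\<And>x. 0 \<le> x \<Longrightarrow> 0 \<le> p x"
  obtains P where "ab_apply P = p"
proof
  have "order_bounded_map p"
    unfolding order_bounded_map_def order_bounded_set_def
  proof (intro allI impI)
    fix M :: "'a set" assume "\<exists>a b. M \<subseteq> {a..b}"
    then obtain a b where "M \<subseteq> {a..b}" by blast
    then have "p ` M \<subseteq> {p a..p b}"
      by (auto intro!: additive_mono[OF assms])
    then show "\<exists>a b. p ` M \<subseteq> {a..b}" by blast
  qed
  then show "ab_apply (Abs_Ab p) = p"
    using assms(1) by (simp add: Abs_Ab_inverse)
qed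

lemma additive_ab_apply: "additive (ab_apply f)"
  using ab_apply[of f] by simp

lemma order_bounded_ab_apply: "order_bounded_map (ab_apply f)"
  using ab_apply[of f] by simp

lemmas ab_apply_add = additive.add[OF additive_ab_apply]
  and ab_apply_diff = additive.diff[OF additive_ab_apply]
  and ab_apply_minus = additive.minus[OF additive_ab_apply]
  and ab_apply_zero = additive.zero[OF additive_ab_apply]

lemma minus_Ab_apply: "ab_apply (f - g) x = ab_apply f x - ab_apply g x"
  unfolding minus_Ab_def plus_Ab.rep_eq uminus_Ab.rep_eq by simp

lemma ab_apply_nonneg: "0 \<le> f \<Longrightarrow> 0 \<le> x \<Longrightarrow> 0 \<le> ab_apply f x"
  by (simp add: less_eq_Ab.rep_eq zero_Ab.rep_eq)

lemma ab_apply_mono: "0 \<le> f \<Longrightarrow> x \<le> y \<Longrightarrow> ab_apply f x \<le> ab_apply f y"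
  by (rule additive_mono[OF additive_ab_apply]) (auto intro: ab_apply_nonneg)

section \<open>Pointwise infima of decreasing nets of maps\<close>

text \<open>The pointwise infimum \<open>q\<close> on the cone is additive because the net
  decreases, so it extends to an element \<open>P\<close> of \<open>A_b(G, H)\<close>. This
  \<open>P\<close> is a lower bound of the net, whence \<open>P \<le> 0\<close>.\<close>

lemma decreasing_Ab_pointwise:
  fixes w :: "'i \<Rightarrow> ('g::directed_ordered_ab_group_add,
    'h::{lattice_ab_group_add, conditionally_complete_lattice}) Ab"
  assumes A: "directed_index A r" and w: "net_decreases_to A r w 0" and x: "0 \<le> x"
    and c: "\<And>\<alpha>. \<alpha> \<in> A \<Longrightarrow> c \<le> ab_apply (w \<alpha>) x"
  shows "c \<le> 0"
proof -
  define q where "q y = Inf ((\<lambda>\<alpha>. ab_apply (w \<alpha>) y) ` A)" for y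
  have ne: "A \<noteq> {}" using A by (simp add: directed_index_def)
  have w0: "0 \<le> ab_apply (w \<alpha>) y" if "\<alpha> \<in> A" "0 \<le> y" for \<alpha> y
    using net_decreases_to_le[OF w that(1)] that(2) by (rule ab_apply_nonneg)
  have le: "q y \<le> ab_apply (w \<alpha>) y" if "\<alpha> \<in> A" "0 \<le> y" for \<alpha> y
    unfolding q_def using that w0 by (intro cInf_lower bdd_belowI2[of _ 0]) auto
  have ge: "d \<le> q y" if "\<And>\<alpha>. \<alpha> \<in> A \<Longrightarrow> d \<le> ab_apply (w \<alpha>) y" for d y
    unfolding q_def using that ne by (intro cInf_greatest) auto
  have q: "q (y + z) = q y + q z" if y: "0 \<le> y" and z: "0 \<le> z" for y z
  proof (rule antisym)
    \<comment> \<open>Independent indices allow the infimum to be taken in each summand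
      separately.\<close>
    have "q (y + z) \<le> ab_apply (w \<alpha>) y + ab_apply (w \<beta>) z" if ab: "\<alpha> \<in> A" "\<beta> \<in> A" for \<alpha> \<beta>
    proof -
      obtain \<gamma> where \<gamma>: "\<gamma> \<in> A" "(\<alpha>, \<gamma>) \<in> r" "(\<beta>, \<gamma>) \<in> r"
        using directed_indexE[OF A ab] .
      have "q (y + z) \<le> ab_apply (w \<gamma>) y + ab_apply (w \<gamma>) z"
        using le[OF \<gamma>(1), of "y + z"] y z by (simp add: ab_apply_add)
      also have "\<dots> \<le> ab_apply (w \<alpha>) y + ab_apply (w \<beta>) z"
        using net_decreases_toD[OF w \<gamma>(2)] net_decreases_toD[OF w \<gamma>(3)] y z
        by (intro add_mono) (auto simp: less_eq_Ab.rep_eq)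
      finally show ?thesis .
    qed
    then have "q (y + z) - ab_apply (w \<beta>) z \<le> q y" if "\<beta> \<in> A" for \<beta>
      using that by (intro ge) (simp add: diff_le_eq)
    then have "q (y + z) - q y \<le> q z"
      by (intro ge) (simp add: diff_le_eq add.commute)
    then show "q (y + z) \<le> q y + q z" by (simp add: diff_le_eq add.commute)
    show "q y + q z \<le> q (y + z)"
      by (rule ge) (use y z in \<open>auto simp: ab_apply_add intro: add_mono le\<close>)
  qed
  obtain p where p: "additive p" "\<And>y. 0 \<le> y \<Longrightarrow> p y = q y"
    using additive_extension[of q, OF q] by blast
  have p0: "0 \<le> p y" if "0 \<le> y" for y
    using that by (simp add: p(2)) (intro ge w0)
  obtain P where P: "ab_apply P = p"
    using additive_nonneg_Ab[OF p(1) p0] .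
  have "P \<le> 0"
    by (rule net_decreases_to_greatest[OF w]) (simp add: less_eq_Ab.rep_eq P p(2) le)
  then have "q x \<le> 0"
    using x by (simp add: less_eq_Ab.rep_eq zero_Ab.rep_eq P p(2))
  moreover have "c \<le> q x" by (rule ge[OF c])
  ultimately show ?thesis by simp
qed

section \<open>The Riesz--Kantorovich formula\<close>

text \<open>The Riesz-Kantorovich formula for the supremum of \<open>f\<close> and \<open>0\<close>.
  As a relation it makes sense for every ordered group \<open>H\<close>; existence is the matter of
  \<open>ex_pos_part\<close>.\<close>

definition is_pos_part ::
    "('g::directed_ordered_ab_group_add, 'h::ordered_ab_group_add) Ab \<Rightarrow> ('g, 'h) Ab \<Rightarrow> bool"
  where "is_pos_part f p \<longleftrightarrow> (\<forall>x\<ge>0. isLub UNIV (ab_apply f ` {0..x}) (ab_apply p x))"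

lemma is_pos_part_upper:
  "is_pos_part f p \<Longrightarrow> 0 \<le> u \<Longrightarrow> u \<le> x \<Longrightarrow> ab_apply f u \<le> ab_apply p x"
  by (auto simp: is_pos_part_def isLub_def isUb_def leastP_def setle_def
      dest!: spec[of _ x] intro: order_trans)

lemma is_pos_part_least:
  "is_pos_part f p \<Longrightarrow> 0 \<le> x \<Longrightarrow> (\<And>u. 0 \<le> u \<Longrightarrow> u \<le> x \<Longrightarrow> ab_apply f u \<le> c) \<Longrightarrow> ab_apply p x \<le> c"
  by (auto simp: is_pos_part_def isLub_def isUb_def leastP_def setle_def setge_def
      dest!: spec[of _ x])

lemma is_pos_partI:
  assumes "\<And>u x. 0 \<le> u \<Longrightarrow> u \<le> x \<Longrightarrow> ab_apply f u \<le> ab_apply p x"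
    and "\<And>x c. 0 \<le> x \<Longrightarrow> (\<And>u. 0 \<le> u \<Longrightarrow> u \<le> x \<Longrightarrow> ab_apply f u \<le> c) \<Longrightarrow> ab_apply p x \<le> c"
  shows "is_pos_part f p"
  using assms
  by (auto simp: is_pos_part_def isLub_def isUb_def leastP_def setle_def setge_def)

lemma is_pos_part_nonneg: "is_pos_part f p \<Longrightarrow> 0 \<le> p"
  using is_pos_part_upper[of f p 0] by (simp add: less_eq_Ab.rep_eq zero_Ab.rep_eq ab_apply_zero)

text \<open>The reflection of \<open>u\<close> to \<open>x - u\<close> maps \<open>{0..x}\<close>
  onto itself and turns \<open>f u\<close> into \<open>f x - f u\<close>. Hence
  \<open>f = p - (p - f)\<close> writes \<open>f\<close> as positive part minus negative
  part.\<close>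

lemma is_pos_part_minus:
  assumes "is_pos_part f p"
  shows "is_pos_part (- f) (p - f)"
proof (rule is_pos_partI)
  fix u x :: 'a assume u: "0 \<le> u" "u \<le> x"
  have "ab_apply f (x - u) \<le> ab_apply p x"
    using u by (intro is_pos_part_upper[OF assms]) auto
  then show "ab_apply (- f) u \<le> ab_apply (p - f) x"
    by (simp add: minus_Ab_apply uminus_Ab.rep_eq ab_apply_diff algebra_simps)
next
  fix x c assume x: "0 \<le> x" and c: "\<And>u. 0 \<le> u \<Longrightarrow> u \<le> x \<Longrightarrow> ab_apply (- f) u \<le> c"
  have "ab_apply p x \<le> c + ab_apply f x"
  proof (rule is_pos_part_least[OF assms x])
    fix u assume "0 \<le> u" "u \<le> x"
    then show "ab_apply f u \<le> c + ab_apply f x"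
      using c[of "x - u"] by (simp add: uminus_Ab.rep_eq ab_apply_diff algebra_simps)
  qed
  then show "ab_apply (p - f) x \<le> c"
    by (simp add: minus_Ab_apply diff_le_eq)
qed

text \<open>Order boundedness of \<open>f\<close> and Dedekind completeness of \<open>H\<close>
  provide the suprema. Riesz decomposition makes them subadditive in \<open>x\<close>; adding
  elements of \<open>{0..x}\<close> and \<open>{0..y}\<close> makes them superadditive.\<close>

lemma ex_pos_part:
  fixes f :: "('g::directed_ordered_ab_group_add,
    'h::{lattice_ab_group_add, conditionally_complete_lattice}) Ab"
  assumes rd: "riesz_decomposition TYPE('g)"
  obtains p where "is_pos_part f p"
proof -
  define q where "q x = Sup (ab_apply f ` {0..x})" for x
  have bdd: "bdd_above (ab_apply f ` {0..x})" for x
  proof -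
    have "order_bounded_set (ab_apply f ` {0..x})"
      using order_bounded_ab_apply[of f] unfolding order_bounded_map_def order_bounded_set_def by blast
    then show ?thesis
      unfolding order_bounded_set_def by (meson bdd_above_Icc bdd_above_mono)
  qed
  have up: "ab_apply f u \<le> q x" if "0 \<le> u" "u \<le> x" for u x
    unfolding q_def using that by (intro cSup_upper bdd) auto
  have least: "q x \<le> c" if "0 \<le> x" "\<And>u. 0 \<le> u \<Longrightarrow> u \<le> x \<Longrightarrow> ab_apply f u \<le> c" for x c
    unfolding q_def using that by (intro cSup_least) auto
  have q: "q (x + y) = q x + q y" if x: "0 \<le> x" and y: "0 \<le> y" for x y
  proof (rule antisym)
    show "q (x + y) \<le> q x + q y"
    proof (rule least)
      fix w assume "0 \<le> w" "w \<le> x + y"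
      then obtain u v where "u \<in> {0..x}" "v \<in> {0..y}" "w = u + v"
        using rd x y unfolding riesz_decomposition_def by (metis atLeastAtMost_iff)
      then show "ab_apply f w \<le> q x + q y"
        by (auto simp: ab_apply_add intro: add_mono up)
    qed (use x y in simp)
    have "ab_apply f u + ab_apply f v \<le> q (x + y)" if "0 \<le> u" "u \<le> x" "0 \<le> v" "v \<le> y" for u v
      using up[of "u + v" "x + y"] that by (simp add: ab_apply_add add_mono)
    then have "q x \<le> q (x + y) - ab_apply f v" if "0 \<le> v" "v \<le> y" for v
      using that x by (intro least) (auto simp: le_diff_eq)
    then have "q y \<le> q (x + y) - q x"
      using y by (intro least) (auto simp: le_diff_eq add.commute)
    then show "q x + q y \<le> q (x + y)" by (simp add: le_diff_eq add.commute)
  qed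
  obtain p where p: "additive p" "\<And>y. 0 \<le> y \<Longrightarrow> p y = q y"
    using additive_extension[of q, OF q] by blast
  have p0: "0 \<le> p y" if "0 \<le> y" for y
    using up[of 0 y] that by (simp add: p(2) ab_apply_zero)
  obtain P where P: "ab_apply P = p"
    using additive_nonneg_Ab[OF p(1) p0] .
  have "is_pos_part f P"
  proof (rule is_pos_partI)
    show "ab_apply f u \<le> ab_apply P x" if "0 \<le> u" "u \<le> x" for u x
      using up[OF that] order_trans[OF that] by (simp add: P p(2))
    show "ab_apply P x \<le> c" if "0 \<le> x" "\<And>u. 0 \<le> u \<Longrightarrow> u \<le> x \<Longrightarrow> ab_apply f u \<le> c" for x c
      using least[OF that] that(1) by (simp add: P p(2))
  qed
  then show thesis by (rule that)
qed

section \<open>Order continuity through positive parts\<close>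

text \<open>For positive \<open>p\<close> the values \<open>p (v \<alpha>)\<close> are nonnegative,
  so the condition says that their infimum is \<open>0\<close>. The index type is the one that
  \<open>net_catching\<close> uses on \<open>'g\<close>.\<close>

definition order_null ::
    "('g::directed_ordered_ab_group_add, 'h::ordered_ab_group_add) Ab \<Rightarrow> bool"
  where "order_null p \<longleftrightarrow> 0 \<le> p \<and>
    (\<forall>(A :: ('g \<times> 'g) set) r v c. directed_index A r \<longrightarrow> net_decreases_to A r v 0 \<longrightarrow>
       (\<forall>\<alpha>\<in>A. c \<le> ab_apply p (v \<alpha>)) \<longrightarrow> c \<le> 0)"

lemma order_null_nonneg: "order_null p \<Longrightarrow> 0 \<le> p"
  by (simp add: order_null_def)

lemma order_nullD:
  fixes p :: "('g::directed_ordered_ab_group_add, 'h::ordered_ab_group_add) Ab"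
    and A :: "('g \<times> 'g) set"
  assumes "order_null p" "directed_index A r" "net_decreases_to A r v 0"
    and "\<And>\<alpha>. \<alpha> \<in> A \<Longrightarrow> c \<le> ab_apply p (v \<alpha>)"
  shows "c \<le> 0"
  using assms unfolding order_null_def by blast

lemma order_nullI:
  fixes p :: "('g::directed_ordered_ab_group_add, 'h::ordered_ab_group_add) Ab"
  assumes "0 \<le> p"
    and "\<And>(A :: ('g \<times> 'g) set) r v c. directed_index A r \<Longrightarrow> net_decreases_to A r v 0 \<Longrightarrow>
       (\<And>\<alpha>. \<alpha> \<in> A \<Longrightarrow> c \<le> ab_apply p (v \<alpha>)) \<Longrightarrow> c \<le> 0"
  shows "order_null p"
  using assms unfolding order_null_def by blast

lemma order_null_zero: "order_null 0"
  by (rule order_nullI) (auto simp: zero_Ab.rep_eq directed_index_def)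

lemma order_null_mono:
  assumes "order_null p" "0 \<le> q" "q \<le> p"
  shows "order_null q"
proof (rule order_nullI[OF assms(2)])
  fix A :: "('a \<times> 'a) set" and r v c
  assume A: "directed_index A r" and v: "net_decreases_to A r v 0"
    and c: "\<And>\<alpha>. \<alpha> \<in> A \<Longrightarrow> c \<le> ab_apply q (v \<alpha>)"
  show "c \<le> 0"
  proof (rule order_nullD[OF assms(1) A v])
    fix \<alpha> assume \<alpha>: "\<alpha> \<in> A"
    have "ab_apply q (v \<alpha>) \<le> ab_apply p (v \<alpha>)"
      using assms(3) net_decreases_to_le[OF v \<alpha>] by (simp add: less_eq_Ab.rep_eq)
    with c[OF \<alpha>] show "c \<le> ab_apply p (v \<alpha>)" by simp
  qed
qed

lemma order_null_add:
  assumes p: "order_null p" and q: "order_null q"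
  shows "order_null (p + q)"
proof (rule order_nullI)
  show "0 \<le> p + q"
    using order_null_nonneg[OF p] order_null_nonneg[OF q] by (rule add_nonneg_nonneg)
  fix A :: "('a \<times> 'a) set" and r v c
  assume A: "directed_index A r" and v: "net_decreases_to A r v 0"
    and c: "\<And>\<alpha>. \<alpha> \<in> A \<Longrightarrow> c \<le> ab_apply (p + q) (v \<alpha>)"
  \<comment> \<open>With the indices decoupled, nullity of \<open>p\<close> removes
    \<open>\<alpha>\<close> and then nullity of \<open>q\<close> removes
    \<open>\<beta>\<close>.\<close>
  have le: "c - ab_apply q (v \<beta>) \<le> ab_apply p (v \<alpha>)" if ab: "\<alpha> \<in> A" "\<beta> \<in> A" for \<alpha> \<beta>
  proof -
    obtain \<gamma> where \<gamma>: "\<gamma> \<in> A" "(\<alpha>, \<gamma>) \<in> r" "(\<beta>, \<gamma>) \<in> r"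
      using directed_indexE[OF A ab] .
    have "c \<le> ab_apply p (v \<gamma>) + ab_apply q (v \<gamma>)"
      using c[OF \<gamma>(1)] by (simp add: plus_Ab.rep_eq)
    also have "\<dots> \<le> ab_apply p (v \<alpha>) + ab_apply q (v \<beta>)"
      by (intro add_mono ab_apply_mono net_decreases_toD[OF v] \<gamma> order_null_nonneg p q)
    finally show ?thesis by (simp add: diff_le_eq)
  qed
  have "c - ab_apply q (v \<beta>) \<le> 0" if "\<beta> \<in> A" for \<beta>
    by (rule order_nullD[OF p A v]) (rule le[OF _ that])
  then show "c \<le> 0"
    by (intro order_nullD[OF q A v]) simp
qed

text \<open>Translation by \<open>x\<close> reduces the claim to nets decreasing to
  \<open>0\<close>.\<close>

lemma order_null_decreases:
  fixes A :: "('g::directed_ordered_ab_group_add \<times> 'g) set" and v :: "'g \<times> 'g \<Rightarrow> 'g"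
  assumes p: "order_null p" and A: "directed_index A r" and v: "net_decreases_to A r v x"
  shows "net_decreases_to A r (\<lambda>\<alpha>. ab_apply p (v \<alpha>)) (ab_apply p x)"
proof (rule net_decreases_toI)
  note mono = ab_apply_mono[OF order_null_nonneg[OF p]]
  show "ab_apply p (v \<beta>) \<le> ab_apply p (v \<alpha>)" if "(\<alpha>, \<beta>) \<in> r" for \<alpha> \<beta>
    by (rule mono[OF net_decreases_toD[OF v that]])
  show "ab_apply p x \<le> ab_apply p (v \<alpha>)" if "\<alpha> \<in> A" for \<alpha>
    by (rule mono[OF net_decreases_to_le[OF v that]])
  fix c assume c: "\<And>\<alpha>. \<alpha> \<in> A \<Longrightarrow> c \<le> ab_apply p (v \<alpha>)"
  have "net_decreases_to A r (\<lambda>\<alpha>. v \<alpha> - x) 0"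
    using net_decreases_to_diff[OF A v net_increases_to_const[OF A, of x]] by simp
  then have "c - ab_apply p x \<le> 0"
    by (rule order_nullD[OF p A]) (simp add: ab_apply_diff c)
  then show "c \<le> ab_apply p x" by simp
qed

lemma order_null_increases:
  fixes A :: "('g::directed_ordered_ab_group_add \<times> 'g) set" and u :: "'g \<times> 'g \<Rightarrow> 'g"
  assumes p: "order_null p" and A: "directed_index A r" and u: "net_increases_to A r u x"
  shows "net_increases_to A r (\<lambda>\<alpha>. ab_apply p (u \<alpha>)) (ab_apply p x)"
proof -
  have "net_decreases_to A r (\<lambda>\<alpha>. - u \<alpha>) (- x)"
    using u by (simp add: net_decreases_to_iff_minus)
  from order_null_decreases[OF p A this] show ?thesis
    by (simp add: net_decreases_to_iff_minus ab_apply_minus)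
qed

text \<open>Since \<open>p\<close> and \<open>q\<close> are monotone, \<open>p - q\<close> maps
  \<open>{u \<alpha>..v \<alpha>}\<close> into the interval from
  \<open>p (u \<alpha>) - q (v \<alpha>)\<close> to \<open>p (v \<alpha>) - q (u \<alpha>)\<close>.
  These endpoints increase and decrease to the value at \<open>x\<close>, so an open
  \<open>U\<close> around that value catches them.\<close>

lemma order_null_diff_Ab_tau_o:
  fixes p q :: "('g::directed_ordered_ab_group_add, 'h::ordered_ab_group_add) Ab"
  assumes p: "order_null p" and q: "order_null q"
  shows "p - q \<in> Ab_tau_o"
proof -
  let ?f = "ab_apply (p - q)"
  have "order_open (?f -` U)" if U: "order_open U" for U
    unfolding order_open_def net_catching_def
  proof (intro ballI allI impI)
    fix x and A :: "('g \<times> 'g) set" and r u v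
    assume x: "x \<in> ?f -` U" and A: "directed_index A r"
      and u: "net_increases_to A r u x" and v: "net_decreases_to A r v x"
    have 1: "net_decreases_to A r (\<lambda>\<alpha>. ab_apply p (v \<alpha>) - ab_apply q (u \<alpha>)) (?f x)"
      unfolding minus_Ab_apply
      by (intro net_decreases_to_diff order_null_decreases order_null_increases A u v p q)
    have "net_decreases_to A r (\<lambda>\<alpha>. ab_apply q (v \<alpha>) - ab_apply p (u \<alpha>)) (- ?f x)"
      unfolding minus_Ab_apply minus_diff_eq
      by (intro net_decreases_to_diff order_null_decreases order_null_increases A u v p q)
    then have 2: "net_increases_to A r (\<lambda>\<alpha>. ab_apply p (u \<alpha>) - ab_apply q (v \<alpha>)) (?f x)"
      by (simp add: net_decreases_to_iff_minus)
    have "net_catching U (?f x)"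
      using U x by (simp add: order_open_def)
    \<comment> \<open>The index set lives in \<open>'g \<times> 'g\<close>, while
      \<open>net_catching U\<close> speaks of \<open>'h \<times> 'h\<close>;
      \<open>net_catchingD\<close> bridges the two types.\<close>
    from net_catchingD[OF this A 2 1] obtain \<alpha> where \<alpha>: "\<alpha> \<in> A"
      "{ab_apply p (u \<alpha>) - ab_apply q (v \<alpha>)..ab_apply p (v \<alpha>) - ab_apply q (u \<alpha>)} \<subseteq> U"
      by blast
    have "?f y \<in> U" if "u \<alpha> \<le> y" "y \<le> v \<alpha>" for y
      using that by (intro subsetD[OF \<alpha>(2)])
        (auto simp: minus_Ab_apply intro!: diff_mono ab_apply_mono order_null_nonneg p q)
    then show "\<exists>\<alpha>\<in>A. {u \<alpha>..v \<alpha>} \<subseteq> ?f -` U"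
      by (intro bexI[OF _ \<alpha>(1)]) auto
  qed
  then show ?thesis
    by (simp add: Ab_tau_o_def continuous_map_def vimage_def)
qed

section \<open>Order continuous maps have order null positive parts\<close>

text \<open>If \<open>y\<close> is not below the infimum \<open>z\<close>, it fails to be below some
  \<open>v \<alpha>\<close>, and then below any element under \<open>v \<alpha>\<close>.\<close>

lemma order_open_not_ge: "order_open {z. \<not> y \<le> z}"
  unfolding order_open_def net_catching_def
proof (intro ballI allI impI)
  fix z and A :: "('a \<times> 'a) set" and r u v
  assume z: "z \<in> {z. \<not> y \<le> z}" and v: "net_decreases_to A r v z"
  then obtain \<alpha> where "\<alpha> \<in> A" "\<not> y \<le> v \<alpha>"
    using net_decreases_to_greatest[OF v] by blast
  then show "\<exists>\<alpha>\<in>A. {u \<alpha>..v \<alpha>} \<subseteq> {z. \<not> y \<le> z}"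
    by (intro bexI[of _ \<alpha>]) (auto intro: order_trans)
qed

text \<open>Otherwise \<open>0\<close> lies in the open preimage of the set of \<open>z\<close> with
  \<open>\<not> c \<le> z\<close>. Caught between the constant net \<open>0\<close> and
  \<open>v\<close>, that preimage contains a whole interval \<open>{0..v \<alpha>}\<close>, against
  the choice of \<open>a\<close>.\<close>

lemma Ab_tau_o_lower_bound:
  assumes f: "f \<in> Ab_tau_o" and A: "directed_index A r" and v: "net_decreases_to A r v 0"
    and a: "\<And>\<alpha>. \<alpha> \<in> A \<Longrightarrow> \<exists>a\<in>{0..v \<alpha>}. c \<le> ab_apply f a"
  shows "c \<le> 0"
proof (rule ccontr)
  assume c: "\<not> c \<le> 0"
  have "order_open {z. \<not> c \<le> ab_apply f z}"
    using f order_open_not_ge[of c] by (auto simp: Ab_tau_o_def continuous_map_def)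
  then have "net_catching {z. \<not> c \<le> ab_apply f z} 0"
    using c by (auto simp: order_open_def ab_apply_zero)
  from net_catchingD[OF this A net_increases_to_const[OF A] v] a show False
    by blast
qed

lemma pos_part_order_null:
  fixes f :: "('g::directed_ordered_ab_group_add, 'h::ordered_ab_group_add) Ab"
  assumes rd: "riesz_decomposition TYPE('g)" and f: "f \<in> Ab_tau_o" and p: "is_pos_part f p"
  shows "order_null p"
proof (rule order_nullI[OF is_pos_part_nonneg[OF p]])
  fix A :: "('g \<times> 'g) set" and r v c
  assume A: "directed_index A r" and v: "net_decreases_to A r v 0"
    and c: "\<And>\<alpha>. \<alpha> \<in> A \<Longrightarrow> c \<le> ab_apply p (v \<alpha>)"
  obtain \<alpha>0 where \<alpha>0: "\<alpha>0 \<in> A" using A by (auto simp: directed_index_def)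
  define y where "y = v \<alpha>0"
  have y: "0 \<le> y" using net_decreases_to_le[OF v \<alpha>0] by (simp add: y_def)
  \<comment> \<open>This is \<open>c \<le> 0\<close> in disguise, in the form that the least upper
    bound property of \<open>p y\<close> can prove.\<close>
  have "ab_apply p y \<le> ab_apply p y - c"
  proof (rule is_pos_part_least[OF p y])
    fix z assume z: "0 \<le> z" "z \<le> y"
    have "c - ab_apply p y + ab_apply f z \<le> 0"
    proof (rule Ab_tau_o_lower_bound[OF f A v])
      fix \<alpha> assume "\<alpha> \<in> A"
      \<comment> \<open>Being beyond \<open>\<alpha>0\<close> gives
        \<open>v \<gamma> \<le> y\<close>, so that \<open>z\<close> can be split; being beyond
        \<open>\<alpha>\<close> puts \<open>a\<close> into \<open>{0..v \<alpha>}\<close>.\<close>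
      then obtain \<gamma> where \<gamma>: "\<gamma> \<in> A" "(\<alpha>, \<gamma>) \<in> r" "(\<alpha>0, \<gamma>) \<in> r"
        using directed_indexE[OF A _ \<alpha>0] by blast
      have v\<gamma>: "0 \<le> v \<gamma>" "v \<gamma> \<le> v \<alpha>" "v \<gamma> \<le> y"
        using net_decreases_to_le[OF v \<gamma>(1)] net_decreases_toD[OF v \<gamma>(2)]
          net_decreases_toD[OF v \<gamma>(3)] by (auto simp: y_def)
      have "z \<in> {0..v \<gamma> + (y - v \<gamma>)}" using z by simp
      then obtain a b where ab: "a \<in> {0..v \<gamma>}" "b \<in> {0..y - v \<gamma>}" "z = a + b"
        using rd v\<gamma> unfolding riesz_decomposition_def by (metis diff_ge_0_iff_ge)
      have "ab_apply f z \<le> ab_apply f a + ab_apply p (y - v \<gamma>)"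
        using is_pos_part_upper[OF p, of b "y - v \<gamma>"] ab by (simp add: ab_apply_add)
      also have "\<dots> \<le> ab_apply f a + (ab_apply p y - c)"
        using c[OF \<gamma>(1)] by (simp add: ab_apply_diff)
      finally have "c - ab_apply p y + ab_apply f z \<le> ab_apply f a"
        by (simp add: algebra_simps)
      then show "\<exists>a\<in>{0..v \<alpha>}. c - ab_apply p y + ab_apply f z \<le> ab_apply f a"
        using ab(1) v\<gamma>(2) by (intro bexI[of _ a]) auto
    qed
    then show "ab_apply f z \<le> ab_apply p y - c" by (simp add: algebra_simps)
  qed
  then show "c \<le> 0" by simp
qed

text \<open>Negation swaps the two nets of a catching pair. This carries results on positive parts
  over to negative parts.\<close>

lemma order_continuous_uminus: "order_continuous (uminus :: 'a::ordered_ab_group_add \<Rightarrow> 'a)"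
proof -
  have "order_open (uminus -` U)" if U: "order_open U" for U :: "'a set"
    unfolding order_open_def net_catching_def
  proof (intro ballI allI impI)
    fix x and A :: "('a \<times> 'a) set" and r u v
    assume x: "x \<in> uminus -` U" and A: "directed_index A r"
      and u: "net_increases_to A r u x" and v: "net_decreases_to A r v x"
    have "net_catching U (- x)"
      using U x by (simp add: order_open_def)
    moreover have "net_increases_to A r (\<lambda>\<alpha>. - v \<alpha>) (- x)"
      using v by (simp add: net_decreases_to_iff_minus)
    moreover have "net_decreases_to A r (\<lambda>\<alpha>. - u \<alpha>) (- x)"
      using u by (simp add: net_decreases_to_iff_minus)
    ultimately obtain \<alpha> where \<alpha>: "\<alpha> \<in> A" "{- v \<alpha>..- u \<alpha>} \<subseteq> U"
      using net_catchingD A by blast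
    have "- y \<in> U" if "u \<alpha> \<le> y" "y \<le> v \<alpha>" for y
      using that by (intro subsetD[OF \<alpha>(2)]) simp
    then show "\<exists>\<alpha>\<in>A. {u \<alpha>..v \<alpha>} \<subseteq> uminus -` U"
      by (intro bexI[OF _ \<alpha>(1)]) auto
  qed
  then show ?thesis
    by (simp add: continuous_map_def vimage_def)
qed

lemma Ab_tau_o_uminus:
  assumes "f \<in> Ab_tau_o"
  shows "- f \<in> Ab_tau_o"
proof -
  have "ab_apply (- f) = uminus \<circ> ab_apply f"
    by (simp add: fun_eq_iff uminus_Ab.rep_eq)
  then show ?thesis
    using assms continuous_map_compose[OF _ order_continuous_uminus] by (auto simp: Ab_tau_o_def)
qed

text \<open>Least upper bounds are unique, so \<open>q\<close> must be the negative part
  \<open>p - f\<close>, and \<open>f = p - q\<close> is a difference of order null maps.\<close>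

lemma pos_parts_order_null_imp_Ab_tau_o:
  assumes "is_pos_part f p" "order_null p" "is_pos_part (- f) q" "order_null q"
  shows "f \<in> Ab_tau_o"
proof -
  note minus = is_pos_part_minus[OF assms(1)]
  have eq: "q = p - f"
  proof -
    have "ab_apply q x = ab_apply (p - f) x" if "0 \<le> x" for x
      by (intro antisym is_pos_part_least[OF assms(3) that] is_pos_part_upper[OF minus]
          is_pos_part_least[OF minus that] is_pos_part_upper[OF assms(3)])
    then show ?thesis
      by (intro antisym) (auto simp: less_eq_Ab.rep_eq)
  qed
  have "f = p - q" by (simp add: eq)
  then show ?thesis
    using order_null_diff_Ab_tau_o[OF assms(2,4)] by simp
qed

lemma Ab_tau_oE:
  fixes f :: "('g::directed_ordered_ab_group_add,
    'h::{lattice_ab_group_add, conditionally_complete_lattice}) Ab"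
  assumes rd: "riesz_decomposition TYPE('g)" and f: "f \<in> Ab_tau_o"
  obtains p q where "order_null p" "order_null q" "f = p - q"
proof -
  obtain p where p: "is_pos_part f p" using ex_pos_part[OF rd] .
  show thesis
    using pos_part_order_null[OF rd f p]
      pos_part_order_null[OF rd Ab_tau_o_uminus[OF f] is_pos_part_minus[OF p]]
    by (rule that) simp
qed

section \<open>The order closed ideal\<close>

text \<open>The members are exactly the differences of order null maps, and these maps are stable
  under sums and under passing to smaller positive maps.\<close>

lemma order_ideal_Ab_tau_o:
  assumes rd: "riesz_decomposition TYPE('g::directed_ordered_ab_group_add)"
  shows "order_ideal (Ab_tau_o ::
    ('g, 'h::{lattice_ab_group_add, conditionally_complete_lattice}) Ab set)"
proof -
  let ?M = "Ab_tau_o :: ('g, 'h) Ab set"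
  have add: "f + g \<in> ?M" if fg: "f \<in> ?M" "g \<in> ?M" for f g
  proof -
    obtain p q where f: "order_null p" "order_null q" "f = p - q"
      using Ab_tau_oE[OF rd fg(1)] .
    obtain p' q' where g: "order_null p'" "order_null q'" "g = p' - q'"
      using Ab_tau_oE[OF rd fg(2)] .
    have "f + g = (p + p') - (q + q')" by (simp add: f g)
    then show ?thesis
      using order_null_diff_Ab_tau_o[OF order_null_add[OF f(1) g(1)] order_null_add[OF f(2) g(2)]]
      by simp
  qed
  have null: "p \<in> ?M" if "order_null p" for p
    using order_null_diff_Ab_tau_o[OF that order_null_zero] by simp
  have "subgroup_add ?M"
    using add Ab_tau_o_uminus null[OF order_null_zero] by (auto simp: subgroup_add_def)
  moreover have "directed_set ?M"
    unfolding directed_set_def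
  proof (intro ballI)
    fix f g assume fg: "f \<in> ?M" "g \<in> ?M"
    obtain p q where f: "order_null p" "order_null q" "f = p - q"
      using Ab_tau_oE[OF rd fg(1)] .
    obtain p' q' where g: "order_null p'" "order_null q'" "g = p' - q'"
      using Ab_tau_oE[OF rd fg(2)] .
    have "p - q \<le> p + p'" "p' - q' \<le> p + p'"
      using f g
      by (auto simp: diff_le_eq add_increasing add_increasing2 order_null_nonneg add.assoc)
    then show "\<exists>h\<in>?M. f \<le> h \<and> g \<le> h"
      using null[OF order_null_add[OF f(1) g(1)]] f(3) g(3) by blast
  qed
  moreover have "full_set ?M"
    unfolding full_set_def
  proof (intro ballI subsetI)
    fix f g h assume fg: "f \<in> ?M" "g \<in> ?M" and h: "h \<in> {f..g}"
    \<comment> \<open>Shifting by \<open>f\<close> places \<open>h - f\<close> between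
      \<open>0\<close> and \<open>g - f = p - q \<le> p\<close>, where domination by
      \<open>p\<close> applies.\<close>
    have "g - f \<in> ?M"
      using add[OF fg(2) Ab_tau_o_uminus[OF fg(1)]] by simp
    then obtain p q where pq: "order_null p" "order_null q" "g - f = p - q"
      using Ab_tau_oE[OF rd] by blast
    have "h - f \<le> p - q"
      using h unfolding pq(3)[symmetric] by simp
    also have "\<dots> \<le> p"
      using order_null_nonneg[OF pq(2)] by simp
    finally have "order_null (h - f)"
      using h by (intro order_null_mono[OF pq(1)]) auto
    from add[OF null[OF this] fg(1)] show "h \<in> ?M" by simp
  qed
  ultimately show ?thesis by (simp add: order_ideal_def)
qed

section \<open>Order closedness\<close>

text \<open>An approximation argument: on the cone, \<open>p\<close> is at most the order null
  positive part of \<open>g \<alpha>\<close> plus the error \<open>w \<alpha>\<close>.\<close>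

lemma pos_part_order_null_limit:
  fixes f :: "('g::directed_ordered_ab_group_add,
    'h::{lattice_ab_group_add, conditionally_complete_lattice}) Ab"
  assumes rd: "riesz_decomposition TYPE('g)" and p: "is_pos_part f p"
    and A: "directed_index A r" and w: "net_decreases_to A r w 0"
    and g: "\<And>\<alpha>. \<alpha> \<in> A \<Longrightarrow> g \<alpha> \<in> Ab_tau_o" and le: "\<And>\<alpha>. \<alpha> \<in> A \<Longrightarrow> f \<le> g \<alpha> + w \<alpha>"
  shows "order_null p"
proof (rule order_nullI[OF is_pos_part_nonneg[OF p]])
  fix B :: "('g \<times> 'g) set" and s v c
  assume B: "directed_index B s" and v: "net_decreases_to B s v 0"
    and c: "\<And>\<beta>. \<beta> \<in> B \<Longrightarrow> c \<le> ab_apply p (v \<beta>)"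
  obtain \<beta>0 where \<beta>0: "\<beta>0 \<in> B" using B by (auto simp: directed_index_def)
  note v0 = net_decreases_to_le[OF v]
  \<comment> \<open>The point \<open>v \<beta>0\<close> is fixed before \<open>\<alpha>\<close>
    varies, so the errors are evaluated at one point, where their infimum is
    \<open>0\<close>.\<close>
  have "c \<le> ab_apply (w \<alpha>) (v \<beta>0)" if \<alpha>: "\<alpha> \<in> A" for \<alpha>
  proof -
    obtain k where k: "is_pos_part (g \<alpha>) k" using ex_pos_part[OF rd] .
    have k0: "order_null k" by (rule pos_part_order_null[OF rd g[OF \<alpha>] k])
    have w0: "0 \<le> w \<alpha>" by (rule net_decreases_to_le[OF w \<alpha>])
    have pk: "ab_apply p x \<le> ab_apply k x + ab_apply (w \<alpha>) x" if "0 \<le> x" for x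
    proof (rule is_pos_part_least[OF p that])
      fix u assume u: "0 \<le> u" "u \<le> x"
      have "ab_apply f u \<le> ab_apply (g \<alpha>) u + ab_apply (w \<alpha>) u"
        using le[OF \<alpha>] u by (simp add: less_eq_Ab.rep_eq plus_Ab.rep_eq)
      also have "\<dots> \<le> ab_apply k x + ab_apply (w \<alpha>) x"
        by (intro add_mono is_pos_part_upper[OF k] ab_apply_mono w0 u)
      finally show "ab_apply f u \<le> \<dots>" .
    qed
    have "c - ab_apply (w \<alpha>) (v \<beta>0) \<le> 0"
    proof (rule order_nullD[OF k0 B v])
      fix \<beta> assume "\<beta> \<in> B"
      then obtain \<gamma> where \<gamma>: "\<gamma> \<in> B" "(\<beta>, \<gamma>) \<in> s" "(\<beta>0, \<gamma>) \<in> s"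
        using directed_indexE[OF B _ \<beta>0] by blast
      have "c \<le> ab_apply k (v \<gamma>) + ab_apply (w \<alpha>) (v \<gamma>)"
        using c[OF \<gamma>(1)] pk[OF v0[OF \<gamma>(1)]] by (rule order_trans)
      also have "\<dots> \<le> ab_apply k (v \<beta>) + ab_apply (w \<alpha>) (v \<beta>0)"
        by (intro add_mono ab_apply_mono net_decreases_toD[OF v] \<gamma> w0 order_null_nonneg k0)
      finally show "c - ab_apply (w \<alpha>) (v \<beta>0) \<le> ab_apply k (v \<beta>)"
        by (simp add: diff_le_eq)
    qed
    then show ?thesis by simp
  qed
  then show "c \<le> 0" by (rule decreasing_Ab_pointwise[OF A w v0[OF \<beta>0]])
qed

text \<open>If no interval avoids the set, each \<open>{u \<alpha>..v \<alpha>}\<close> contains a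
  member \<open>g \<alpha>\<close>. It approximates \<open>f\<close> from both sides up to
  \<open>v \<alpha> - u \<alpha>\<close>, so the positive parts of \<open>f\<close> and
  \<open>- f\<close> are order null and \<open>f\<close> is itself a member.\<close>

lemma order_closed_Ab_tau_o:
  assumes rd: "riesz_decomposition TYPE('g::directed_ordered_ab_group_add)"
  shows "order_closed (Ab_tau_o ::
    ('g, 'h::{lattice_ab_group_add, conditionally_complete_lattice}) Ab set)"
proof -
  let ?M = "Ab_tau_o :: ('g, 'h) Ab set"
  have "order_open (- ?M)"
    unfolding order_open_def net_catching_def
  proof (intro ballI allI impI)
    fix f and A :: "(('g, 'h) Ab \<times> ('g, 'h) Ab) set" and r u v
    assume f: "f \<in> - ?M" and A: "directed_index A r"
      and u: "net_increases_to A r u f" and v: "net_decreases_to A r v f"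
    show "\<exists>\<alpha>\<in>A. {u \<alpha>..v \<alpha>} \<subseteq> - ?M"
    proof (rule ccontr)
      assume "\<not> ?thesis"
      then have "\<forall>\<alpha>\<in>A. \<exists>g. g \<in> ?M \<and> g \<in> {u \<alpha>..v \<alpha>}" by blast
      then obtain g where "\<forall>\<alpha>\<in>A. g \<alpha> \<in> ?M \<and> g \<alpha> \<in> {u \<alpha>..v \<alpha>}"
        unfolding bchoice_iff ..
      then have g: "\<And>\<alpha>. \<alpha> \<in> A \<Longrightarrow> g \<alpha> \<in> ?M" "\<And>\<alpha>. \<alpha> \<in> A \<Longrightarrow> u \<alpha> \<le> g \<alpha>"
        "\<And>\<alpha>. \<alpha> \<in> A \<Longrightarrow> g \<alpha> \<le> v \<alpha>"
        by auto
      have w: "net_decreases_to A r (\<lambda>\<alpha>. v \<alpha> - u \<alpha>) 0"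
        using net_decreases_to_diff[OF A v u] by simp
      obtain p where p: "is_pos_part f p" using ex_pos_part[OF rd] .
      obtain q where q: "is_pos_part (- f) q" using ex_pos_part[OF rd] .
      have "f \<le> g \<alpha> + (v \<alpha> - u \<alpha>)" if "\<alpha> \<in> A" for \<alpha>
        using add_mono[OF g(2)[OF that] net_decreases_to_le[OF v that]]
        by (simp add: algebra_simps)
      then have "order_null p"
        using g(1) by (intro pos_part_order_null_limit[OF rd p A w, of g])
      moreover have "- f \<le> - g \<alpha> + (v \<alpha> - u \<alpha>)" if "\<alpha> \<in> A" for \<alpha>
        using add_mono[OF g(3)[OF that] net_increases_to_ge[OF u that]]
        by (simp add: algebra_simps)
      then have "order_null q"
        using g(1) by (intro pos_part_order_null_limit[OF rd q A w, of "\<lambda>\<alpha>. - g \<alpha>"] Ab_tau_o_uminus)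
      ultimately have "f \<in> ?M"
        by (rule pos_parts_order_null_imp_Ab_tau_o[OF p _ q])
      with f show False by simp
    qed
  qed
  then show ?thesis by (simp add: closedin_def Compl_eq_Diff_UNIV)
qed

theorem theorem7p8:
  assumes "riesz_decomposition TYPE('g::directed_ordered_ab_group_add)"
  shows "order_closed (Ab_tau_o ::
           ('g, 'h::{lattice_ab_group_add, conditionally_complete_lattice}) Ab set)
       \<and> order_ideal (Ab_tau_o :: ('g, 'h) Ab set)"
  using order_closed_Ab_tau_o[OF assms] order_ideal_Ab_tau_o[OF assms] by (rule conjI)

end
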